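(* Let $L$ be a locale. Then $L$ is IDM if and only if $L$ is both $\bot$-scattered and IED.
   Context: A locale (= frame) is a complete lattice $L$ with $a\wedge\bigvee B=\bigvee\{a\wedge b\mid b\in B\}$ for all $a\in L$, $B\subseteq L$. It is a complete Heyting algebra with Heyting operation $\to$; the pseudocomplement of $a$ is $a^*=a\to 0$, and $a^{**}=(a^* )^*$. For arbitrary families $\{a_i\}_{i\in I}\subseteq L$ (arbitrary index set): $L$ is IDM (infinitely De Morgan) if always $(\bigwedge a_i)^*\le\bigvee a_i^*$; $L$ is IED (infinitely extremally disconnected) if always $(\bigvee a_i)^{**}\le\bigvee a_i^{**}$; $L$ is $\bot$-scattered if always $\bigwedge a_i^{**}\le(\bigwedge a_i)^{**}$. *)

theory Defs
  imports Main
begin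

text \<open>
  Only binary meets are required to distribute over arbitrary joins.  This is weaker than the
  library class \<^class>\<open>complete_distrib_lattice\<close>, which demands complete distributivity.
\<close>

class frame = complete_lattice +
  assumes inf_Sup_frame: "inf a (Sup B) = Sup {inf a b | b. b \<in> B}"

subclass (in complete_distrib_lattice) frame
  by unfold_locales (simp add: inf_Sup image_def Bex_def conj_commute)

definition heyting_imp :: "'a::frame \<Rightarrow> 'a \<Rightarrow> 'a" (infixr "\<rightarrow>\<^sub>H" 60)
  where "a \<rightarrow>\<^sub>H b = Sup {c. inf c a \<le> b}"

lemma heyting_imp_adjoint: "c \<le> a \<rightarrow>\<^sub>H b \<longleftrightarrow> inf c a \<le> b"
proof
  assume "c \<le> a \<rightarrow>\<^sub>H b"
  then have "inf c a \<le> inf a (a \<rightarrow>\<^sub>H b)"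
    by (simp add: inf.coboundedI1)
  also have "\<dots> \<le> b"
    by (auto simp: heyting_imp_def inf_Sup_frame inf_commute intro: Sup_least)
  finally show "inf c a \<le> b" .
next
  assume "inf c a \<le> b"
  then show "c \<le> a \<rightarrow>\<^sub>H b"
    by (simp add: heyting_imp_def Sup_upper)
qed

definition pseudocompl :: "'a::frame \<Rightarrow> 'a"
  where "pseudocompl a = a \<rightarrow>\<^sub>H bot"

text \<open>
  The three properties below concern arbitrary families of elements.  Meets and joins of a family
  depend only on its range, so the families are given as arbitrary subsets (the empty one included);
  the lemmas \<open>IDM_family\<close>, \<open>IED_family\<close> and \<open>bot_scattered_family\<close> recover
  families over index sets of any type.  The type argument names the frame.
\<close>

definition IDM :: "'a::frame itself \<Rightarrow> bool"
  where "IDM L \<longleftrightarrow> (\<forall>A :: 'a set. pseudocompl (INF a\<in>A. a) \<le> (SUP a\<in>A. pseudocompl a))"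

definition IED :: "'a::frame itself \<Rightarrow> bool"
  where "IED L \<longleftrightarrow>
    (\<forall>A :: 'a set. pseudocompl (pseudocompl (SUP a\<in>A. a)) \<le> (SUP a\<in>A. pseudocompl (pseudocompl a)))"

definition bot_scattered :: "'a::frame itself \<Rightarrow> bool"
  where "bot_scattered L \<longleftrightarrow>
    (\<forall>A :: 'a set. (INF a\<in>A. pseudocompl (pseudocompl a)) \<le> pseudocompl (pseudocompl (INF a\<in>A. a)))"

lemma IDM_family:
  fixes a :: "'i \<Rightarrow> 'a::frame"
  assumes "IDM TYPE('a)"
  shows "pseudocompl (INF i\<in>I. a i) \<le> (SUP i\<in>I. pseudocompl (a i))"
  using assms[unfolded IDM_def, rule_format, of "a ` I"] by (simp add: image_image)

lemma IED_family:
  fixes a :: "'i \<Rightarrow> 'a::frame"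
  assumes "IED TYPE('a)"
  shows "pseudocompl (pseudocompl (SUP i\<in>I. a i)) \<le> (SUP i\<in>I. pseudocompl (pseudocompl (a i)))"
  using assms[unfolded IED_def, rule_format, of "a ` I"] by (simp add: image_image)

lemma bot_scattered_family:
  fixes a :: "'i \<Rightarrow> 'a::frame"
  assumes "bot_scattered TYPE('a)"
  shows "(INF i\<in>I. pseudocompl (pseudocompl (a i))) \<le> pseudocompl (pseudocompl (INF i\<in>I. a i))"
  using assms[unfolded bot_scattered_def, rule_format, of "a ` I"] by (simp add: image_image)

end

theory Submission
  imports Defs
begin

text \<open>
  The pseudocomplement is a Galois connection of \<open>L\<close> with its dual, so it turns joins into meets:
  \<open>(\<Or>a\<^sub>i)\<^sup>* = \<And>a\<^sub>i\<^sup>*\<close>, and \<open>a\<^sup>*\<^sup>*\<^sup>* = a\<^sup>*\<close>.  Given IDM, apply it to the \<open>a\<^sub>i\<^sup>*\<close> to obtain IED, and take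
  pseudocomplements to obtain \<open>\<bottom>\<close>-scatteredness.  Conversely,
  \<open>(\<And>a\<^sub>i)\<^sup>* = (\<And>a\<^sub>i)\<^sup>*\<^sup>*\<^sup>* \<le> (\<And>a\<^sub>i\<^sup>*\<^sup>*)\<^sup>* = (\<Or>a\<^sub>i\<^sup>*)\<^sup>*\<^sup>* \<le> \<Or>a\<^sub>i\<^sup>*\<^sup>*\<^sup>* = \<Or>a\<^sub>i\<^sup>*\<close>.
\<close>

lemma le_pseudocompl_iff: "c \<le> pseudocompl a \<longleftrightarrow> inf c a = bot"
  by (simp add: pseudocompl_def heyting_imp_adjoint bot_unique)

text \<open>Disjointness is symmetric.\<close>

lemma le_pseudocompl_swap: "c \<le> pseudocompl a \<longleftrightarrow> a \<le> pseudocompl c"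
  by (simp add: le_pseudocompl_iff inf_commute)

lemma le_pseudocompl_pseudocompl: "a \<le> pseudocompl (pseudocompl a)"
  by (simp add: le_pseudocompl_swap[of a])

lemma pseudocompl_antimono: "a \<le> b \<Longrightarrow> pseudocompl b \<le> pseudocompl a"
  using le_pseudocompl_pseudocompl[of b] by (simp add: le_pseudocompl_swap[of _ a])

text \<open>One half reverses \<open>a \<le> pseudocompl (pseudocompl a)\<close>; the other is that
  law at \<open>pseudocompl a\<close>.\<close>

lemma pseudocompl_triple: "pseudocompl (pseudocompl (pseudocompl a)) = pseudocompl a"
  by (intro order.antisym pseudocompl_antimono le_pseudocompl_pseudocompl)

lemma pseudocompl_SUP: "pseudocompl (SUP i\<in>I. f i) = (INF i\<in>I. pseudocompl (f i))"
proof (rule order.antisym)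
  show "pseudocompl (SUP i\<in>I. f i) \<le> (INF i\<in>I. pseudocompl (f i))"
    by (intro INF_greatest pseudocompl_antimono SUP_upper)
  show "(INF i\<in>I. pseudocompl (f i)) \<le> pseudocompl (SUP i\<in>I. f i)"
    \<comment> \<open>Swapping puts the join on the left, where it is bounded termwise.\<close>
    unfolding le_pseudocompl_swap[of "INF i\<in>I. pseudocompl (f i)"]
    by (intro SUP_least, subst le_pseudocompl_swap) (rule INF_lower)
qed

lemma IDM_imp_IED:
  assumes "IDM TYPE('a::frame)"
  shows "IED TYPE('a)"
  unfolding IED_def
  \<comment> \<open>The inner pseudocomplement of the join becomes a meet, leaving IDM for the
    elements \<open>pseudocompl a\<close>.\<close>
  by (intro allI, unfold pseudocompl_SUP) (rule IDM_family[OF assms])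

lemma IDM_imp_bot_scattered:
  assumes "IDM TYPE('a::frame)"
  shows "bot_scattered TYPE('a)"
  \<comment> \<open>The meet on the left becomes
    \<open>pseudocompl (SUP a\<in>A. pseudocompl a)\<close>, so antitonicity reduces the goal to
    IDM.\<close>
  unfolding bot_scattered_def pseudocompl_SUP[symmetric]
  by (intro allI pseudocompl_antimono IDM_family assms)

lemma bot_scattered_IED_imp_IDM:
  assumes "bot_scattered TYPE('a::frame)" and "IED TYPE('a)"
  shows "IDM TYPE('a)"
  unfolding IDM_def
proof
  fix A :: "'a set"
  have "pseudocompl (INF a\<in>A. a) = pseudocompl (pseudocompl (pseudocompl (INF a\<in>A. a)))"
    by (simp only: pseudocompl_triple)
  also have "\<dots> \<le> pseudocompl (INF a\<in>A. pseudocompl (pseudocompl a))"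
    by (intro pseudocompl_antimono bot_scattered_family assms)
  also have "\<dots> = pseudocompl (pseudocompl (SUP a\<in>A. pseudocompl a))"
    by (simp only: pseudocompl_SUP)
  also have "\<dots> \<le> (SUP a\<in>A. pseudocompl (pseudocompl (pseudocompl a)))"
    by (intro IED_family assms)
  also have "\<dots> = (SUP a\<in>A. pseudocompl a)"
    by (simp only: pseudocompl_triple)
  finally show "pseudocompl (INF a\<in>A. a) \<le> (SUP a\<in>A. pseudocompl a)" .
qed

theorem fact3p10:
  shows "IDM TYPE('a::frame) \<longleftrightarrow> bot_scattered TYPE('a) \<and> IED TYPE('a)"
  using IDM_imp_IED IDM_imp_bot_scattered bot_scattered_IED_imp_IDM by blast

end
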